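(* If $G$ is a finite simple square-free graph with minimum degree at least $3$, then there exists an avoidance coupling of two walkers on $G$.
   Context: Graphs have nonempty vertex set. A graph $G=(V,E)$ is square-free if whenever $v_1,v_2,v_3,v_4\in V$ are distinct, at least one of $\{v_1,v_2\},\{v_2,v_3\},\{v_3,v_4\},\{v_4,v_1\}$ is not in $E$. For $v\in V$, write $N(v)=\{u\in V:\{u,v\}\in E\}$ and $\deg(v)=|N(v)|$. A (discrete-time) simple random walk on $G$ is a $V$-valued Markov chain $(X_t)_{t\geq 0}$ (with arbitrary initial law) such that $\mathbb{P}(X_{t+1}=u\mid X_t=v)=1/\deg(v)$ if $u\in N(v)$ and $0$ otherwise. An avoidance coupling (of two walkers) on $G$ is a discrete-time $(V\times V)$-valued process $(A_t,B_t)_{t\geq 0}$ such that: (1) (faithfulness) $(A_t)_{t\geq 0}$ and $(B_t)_{t\geq 0}$ are each simple random walks on $G$, each with respect to its own history; and (2) (avoidance) $B_t\notin\{A_t,A_{t+1}\}$ for all $t\geq 0$. *)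

theory Defs
  imports "HOL-Probability.Probability"
begin

locale simple_graph =
  fixes V :: "'a set" and E :: "'a set set"
  assumes nonempty: "V \<noteq> {}"
    and edges: "e \<in> E \<Longrightarrow> e \<subseteq> V \<and> card e = 2"

definition square_free :: "'a set \<Rightarrow> 'a set set \<Rightarrow> bool" where
  "square_free V E \<longleftrightarrow>
     (\<forall>v1\<in>V. \<forall>v2\<in>V. \<forall>v3\<in>V. \<forall>v4\<in>V. distinct [v1, v2, v3, v4] \<longrightarrow>
        {v1, v2} \<notin> E \<or> {v2, v3} \<notin> E \<or> {v3, v4} \<notin> E \<or> {v4, v1} \<notin> E)"

definition neighbours :: "'a set \<Rightarrow> 'a set set \<Rightarrow> 'a \<Rightarrow> 'a set" where
  "neighbours V E v = {u \<in> V. {u, v} \<in> E}"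

definition deg :: "'a set \<Rightarrow> 'a set set \<Rightarrow> 'a \<Rightarrow> nat" where
  "deg V E v = card (neighbours V E v)"

definition min_degree :: "'a set \<Rightarrow> 'a set set \<Rightarrow> nat" where
  "min_degree V E = (INF v\<in>V. deg V E v)"

text \<open>Conditional probabilities are constrained only when the conditioning event has
  positive probability. The chain is Markov with respect to its own history
  \<open>X 0, \<dots>, X t\<close>; the path \<open>x\<close> matters only up to time \<open>t\<close>.\<close>

definition markov_chain :: "'w measure \<Rightarrow> 'a set \<Rightarrow> (nat \<Rightarrow> 'w \<Rightarrow> 'a) \<Rightarrow> bool" where
  "markov_chain M V X \<longleftrightarrow>
     prob_space M \<and>
     (\<forall>t. X t \<in> measurable M (count_space V)) \<and>
     (\<forall>t x. \<forall>u\<in>V. \<P>(\<omega> in M. \<forall>s\<le>t. X s \<omega> = x s) > 0 \<longrightarrow>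
        \<P>(\<omega> in M. X (Suc t) \<omega> = u \<bar> \<forall>s\<le>t. X s \<omega> = x s) =
        \<P>(\<omega> in M. X (Suc t) \<omega> = u \<bar> X t \<omega> = x t))"

definition simple_random_walk ::
  "'a set \<Rightarrow> 'a set set \<Rightarrow> 'w measure \<Rightarrow> (nat \<Rightarrow> 'w \<Rightarrow> 'a) \<Rightarrow> bool" where
  "simple_random_walk V E M X \<longleftrightarrow>
     markov_chain M V X \<and>
     (\<forall>t. \<forall>v\<in>V. \<forall>u\<in>V. \<P>(\<omega> in M. X t \<omega> = v) > 0 \<longrightarrow>
        \<P>(\<omega> in M. X (Suc t) \<omega> = u \<bar> X t \<omega> = v) =
          (if u \<in> neighbours V E v then 1 / real (deg V E v) else 0))"

text \<open>The processes live on a common probability space \<open>M\<close>. As usual for random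
  processes, the avoidance condition is required almost surely, simultaneously for all times.\<close>

definition avoidance_coupling ::
  "'a set \<Rightarrow> 'a set set \<Rightarrow> 'w measure \<Rightarrow> (nat \<Rightarrow> 'w \<Rightarrow> 'a) \<Rightarrow> (nat \<Rightarrow> 'w \<Rightarrow> 'a) \<Rightarrow> bool" where
  "avoidance_coupling V E M A B \<longleftrightarrow>
     prob_space M \<and>
     (\<forall>t. (\<lambda>\<omega>. (A t \<omega>, B t \<omega>)) \<in> measurable M (count_space (V \<times> V))) \<and>
     simple_random_walk V E M A \<and>
     simple_random_walk V E M B \<and>
     (AE \<omega> in M. \<forall>t. B t \<omega> \<notin> {A t \<omega>, A (Suc t) \<omega>})"

text \<open>HOL cannot quantify existentially over the type of the sample space. We use the type of
  sequences in \<open>V \<times> V\<close>: the law of any avoidance coupling on a finite graph lives on this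
  path space, so nothing is lost.\<close>

definition has_avoidance_coupling :: "'a set \<Rightarrow> 'a set set \<Rightarrow> bool" where
  "has_avoidance_coupling V E \<longleftrightarrow>
     (\<exists>(M :: (nat \<Rightarrow> 'a \<times> 'a) measure) A B. avoidance_coupling V E M A B)"

end

theory Submission
  imports Defs
begin

text \<open>The coupling keeps the two walkers at distinct, non-adjacent vertices, so that the first one
  can never step onto the second. From such a pair \<open>(a, b)\<close>, the next pair has to be drawn
  from a coupling of the uniform laws on the neighbourhoods of \<open>a\<close> and \<open>b\<close>, again
  supported on distinct non-adjacent pairs. Choosing independent uniform three-element subsets of the
  two neighbourhoods reduces this to a perfect matching between two sets of size three, and
  square-freeness excludes each of the obstructions in Hall's theorem. The pair process is a Markov
  chain for which each coordinate makes a simple random walk step given the joint history, hence also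
  given its own.\<close>

section \<open>Uniform laws on finite sets and their couplings\<close>

lemma card_subsets_containing:
  assumes "finite A" and "u \<in> A" and "0 < k"
  shows "card {X. X \<subseteq> A \<and> card X = k \<and> u \<in> X} = (card A - 1) choose (k - 1)"
proof -
  have "bij_betw (insert u) {Y. Y \<subseteq> A - {u} \<and> card Y = k - 1}
    {X. X \<subseteq> A \<and> card X = k \<and> u \<in> X}"
  proof (rule bij_betw_byWitness[where f' = "\<lambda>X. X - {u}"])
    show "insert u ` {Y. Y \<subseteq> A - {u} \<and> card Y = k - 1} \<subseteq> {X. X \<subseteq> A \<and> card X = k \<and> u \<in> X}"
    proof (rule image_subsetI)
      fix Y assume "Y \<in> {Y. Y \<subseteq> A - {u} \<and> card Y = k - 1}"
      then have Y: "Y \<subseteq> A - {u}" "card Y = k - 1"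
        by simp_all
      then have "finite Y" "u \<notin> Y"
        using assms(1) finite_subset by blast+
      then show "insert u Y \<in> {X. X \<subseteq> A \<and> card X = k \<and> u \<in> X}"
        using Y assms(2,3) by auto
    qed
    show "(\<lambda>X. X - {u}) ` {X. X \<subseteq> A \<and> card X = k \<and> u \<in> X} \<subseteq> {Y. Y \<subseteq> A - {u} \<and> card Y = k - 1}"
      by auto
  qed auto
  then have "card {X. X \<subseteq> A \<and> card X = k \<and> u \<in> X} = card {Y. Y \<subseteq> A - {u} \<and> card Y = k - 1}"
    by (simp add: bij_betw_same_card)
  then show ?thesis
    using assms(1,2) by (simp add: n_subsets)
qed

text \<open>Double counting: with \<open>n = card A\<close>, each element of \<open>A\<close> lies
  in (n-1 choose k-1) of the k-subsets, and k * (n choose k) = n * (n-1 choose k-1), so it receives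
  mass 1/n. This allows uniform laws on sets of different sizes to be coupled through subsets of a
  common size.\<close>

lemma pmf_of_set_via_subsets:
  assumes "finite A" and "0 < k" and "k \<le> card A"
  shows "pmf_of_set {X. X \<subseteq> A \<and> card X = k} \<bind> pmf_of_set = pmf_of_set A"
proof (rule pmf_eqI)
  fix u
  define S where "S = {X. X \<subseteq> A \<and> card X = k}"
  have fin: "finite S"
    using assms(1) by (simp add: S_def)
  have cardS: "card S = card A choose k"
    using assms(1) by (simp add: S_def n_subsets)
  then have pos: "card S > 0"
    using assms(3) by (simp add: zero_less_binomial)
  then have ne: "S \<noteq> {}"
    by (metis card.empty less_irrefl)
  have "A \<noteq> {}"
    using assms(2,3) by (metis card.empty not_le)
  have pmf_X: "pmf (pmf_of_set X) u = (if u \<in> X then 1 / k else 0)" if "X \<in> S" for X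
  proof -
    have "card X = k"
      using that by (simp add: S_def)
    moreover from this have "finite X" "X \<noteq> {}"
      using assms(2) card.infinite by force+
    ultimately show ?thesis
      by (simp add: pmf_of_set)
  qed
  have "pmf (pmf_of_set S \<bind> pmf_of_set) u = (\<Sum>X\<in>S. pmf (pmf_of_set X) u) / card S"
    using fin ne by (simp add: pmf_bind integral_pmf_of_set)
  also have "(\<Sum>X\<in>S. pmf (pmf_of_set X) u) = card {X \<in> S. u \<in> X} / k"
    using fin by (simp add: pmf_X sum.If_cases Int_def)
  also have "\<dots> / card S = pmf (pmf_of_set A) u"
  proof (cases "u \<in> A")
    case False
    then have "{X \<in> S. u \<in> X} = {}"
      by (auto simp: S_def)
    then have "card {X \<in> S. u \<in> X} = 0"
      by (simp only: card.empty)
    with False show ?thesis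
      using assms(1) \<open>A \<noteq> {}\<close> by simp
  next
    case True
    have "{X \<in> S. u \<in> X} = {X. X \<subseteq> A \<and> card X = k \<and> u \<in> X}"
      by (auto simp: S_def)
    then have "k * card S = card A * card {X \<in> S. u \<in> X}"
      using times_binomial_minus1_eq[OF assms(2), of "card A"] cardS
        card_subsets_containing[OF assms(1) True assms(2)] by (simp only:)
    then have "real k * card S = real (card A) * card {X \<in> S. u \<in> X}"
      by (metis of_nat_mult)
    moreover have "card A > 0"
      using assms(2,3) by linarith
    moreover from calculation(1) have "card {X \<in> S. u \<in> X} \<noteq> 0"
      using pos assms(2) by (metis mult_eq_0_iff of_nat_0 of_nat_eq_0_iff less_irrefl)
    ultimately have "real (card {X \<in> S. u \<in> X}) / k / card S = 1 / card A"
      using pos assms(2) by (simp add: field_simps)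
    with True show ?thesis
      using assms(1) \<open>A \<noteq> {}\<close> by simp
  qed
  finally show "pmf (pmf_of_set {X. X \<subseteq> A \<and> card X = k} \<bind> pmf_of_set) u = pmf (pmf_of_set A) u"
    by (simp only: S_def)
qed

text \<open>The coupling is the law of \<open>(x, f x)\<close> for uniform \<open>x\<close>.\<close>

lemma rel_pmf_of_set_bij_betw:
  assumes "finite X" and "X \<noteq> {}" and "bij_betw f X Y" and "\<And>x. x \<in> X \<Longrightarrow> R x (f x)"
  shows "rel_pmf R (pmf_of_set X) (pmf_of_set Y)"
proof -
  have "rel_pmf R (pmf_of_set X) (map_pmf f (pmf_of_set X))"
    unfolding pmf.rel_map using assms by (intro rel_pmf_reflI) simp
  then show ?thesis
    using assms by (simp add: map_pmf_of_set_bij_betw)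
qed

lemma rel_pmf_of_set_three:
  assumes "distinct [x1, x2, x3]" and "distinct [y1, y2, y3]"
    and "R x1 y1" and "R x2 y2" and "R x3 y3"
  shows "rel_pmf R (pmf_of_set {x1, x2, x3}) (pmf_of_set {y1, y2, y3})"
proof (rule rel_pmf_of_set_bij_betw)
  let ?f = "\<lambda>x. if x = x1 then y1 else if x = x2 then y2 else y3"
  show "bij_betw ?f {x1, x2, x3} {y1, y2, y3}"
    using assms(1,2) by (auto simp: bij_betw_def inj_on_def)
  show "R x (?f x)" if "x \<in> {x1, x2, x3}" for x
    using that assms by auto
qed auto

text \<open>The three non-degeneracy conditions are Hall's condition for a 3-by-3 relation.\<close>

lemma rel_pmf_of_set_three_Hall:
  assumes "card X = 3" and "card Y = 3"
    and row: "\<And>x. x \<in> X \<Longrightarrow> \<exists>y\<in>Y. R x y"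
    and col: "\<And>y. y \<in> Y \<Longrightarrow> \<exists>x\<in>X. R x y"
    and square: "\<And>x x' y y'. \<lbrakk>x \<in> X; x' \<in> X; x \<noteq> x'; y \<in> Y; y' \<in> Y; y \<noteq> y'\<rbrakk>
      \<Longrightarrow> R x y \<or> R x y' \<or> R x' y \<or> R x' y'"
  shows "rel_pmf R (pmf_of_set X) (pmf_of_set Y)"
proof -
  obtain x1 x2 x3 where X: "X = {x1, x2, x3}" "distinct [x1, x2, x3]"
    using assms(1) by (auto simp: card_3_iff)
  obtain y1 y2 y3 where Y: "Y = {y1, y2, y3}" "distinct [y1, y2, y3]"
    using assms(2) by (auto simp: card_3_iff)
  have rows: "R x1 y1 \<or> R x1 y2 \<or> R x1 y3" "R x2 y1 \<or> R x2 y2 \<or> R x2 y3"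
    "R x3 y1 \<or> R x3 y2 \<or> R x3 y3"
    using row unfolding X(1) Y(1) by blast+
  have cols: "R x1 y1 \<or> R x2 y1 \<or> R x3 y1" "R x1 y2 \<or> R x2 y2 \<or> R x3 y2"
    "R x1 y3 \<or> R x2 y3 \<or> R x3 y3"
    using col unfolding X(1) Y(1) by blast+
  have squares:
    "R x1 y1 \<or> R x1 y2 \<or> R x2 y1 \<or> R x2 y2" "R x1 y1 \<or> R x1 y3 \<or> R x2 y1 \<or> R x2 y3"
    "R x1 y2 \<or> R x1 y3 \<or> R x2 y2 \<or> R x2 y3" "R x1 y1 \<or> R x1 y2 \<or> R x3 y1 \<or> R x3 y2"
    "R x1 y1 \<or> R x1 y3 \<or> R x3 y1 \<or> R x3 y3" "R x1 y2 \<or> R x1 y3 \<or> R x3 y2 \<or> R x3 y3"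
    "R x2 y1 \<or> R x2 y2 \<or> R x3 y1 \<or> R x3 y2" "R x2 y1 \<or> R x2 y3 \<or> R x3 y1 \<or> R x3 y3"
    "R x2 y2 \<or> R x2 y3 \<or> R x3 y2 \<or> R x3 y3"
    using X(2) Y(2) by (simp_all add: square X(1) Y(1))
  \<comment> \<open>The six cases are the six perfect matchings. By the Frobenius-Koenig theorem, a
    3-by-3 relation without a perfect matching has an empty block of shape 1-by-3, 3-by-1 or 2-by-2;
    \<open>rows\<close>, \<open>cols\<close> and \<open>squares\<close> exclude all of these, so the
    claim is a propositional tautology in nine atoms.\<close>
  consider "R x1 y1" "R x2 y2" "R x3 y3" | "R x1 y1" "R x2 y3" "R x3 y2"
    | "R x1 y2" "R x2 y1" "R x3 y3" | "R x1 y2" "R x2 y3" "R x3 y1"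
    | "R x1 y3" "R x2 y1" "R x3 y2" | "R x1 y3" "R x2 y2" "R x3 y1"
    using rows cols squares by argo
  then show ?thesis
  proof cases
    case 1
    with rel_pmf_of_set_three[of x1 x2 x3 y1 y2 y3 R] X Y show ?thesis
      by simp
  next
    case 2
    with rel_pmf_of_set_three[of x1 x2 x3 y1 y3 y2 R] X Y show ?thesis
      by (auto simp: insert_commute)
  next
    case 3
    with rel_pmf_of_set_three[of x1 x2 x3 y2 y1 y3 R] X Y show ?thesis
      by (auto simp: insert_commute)
  next
    case 4
    with rel_pmf_of_set_three[of x1 x2 x3 y2 y3 y1 R] X Y show ?thesis
      by (auto simp: insert_commute)
  next
    case 5
    with rel_pmf_of_set_three[of x1 x2 x3 y3 y1 y2 R] X Y show ?thesis
      by (auto simp: insert_commute)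
  next
    case 6
    with rel_pmf_of_set_three[of x1 x2 x3 y3 y2 y1 R] X Y show ?thesis
      by (auto simp: insert_commute)
  qed
qed

text \<open>The hypotheses say that the complement of \<open>R\<close> contains no 1-by-3, 3-by-1 or
  2-by-2 block. They pass to any three-element subsets of \<open>A\<close> and \<open>B\<close>,
  which can then be matched; averaging over random subsets restores the uniform laws on
  \<open>A\<close> and \<open>B\<close>.\<close>

lemma rel_pmf_of_set_sparse_complement:
  assumes A: "finite A" "card A \<ge> 3" and B: "finite B" "card B \<ge> 3"
    and row: "\<And>x Y. \<lbrakk>x \<in> A; Y \<subseteq> B; card Y = 3\<rbrakk> \<Longrightarrow> \<exists>y\<in>Y. R x y"
    and col: "\<And>X y. \<lbrakk>X \<subseteq> A; card X = 3; y \<in> B\<rbrakk> \<Longrightarrow> \<exists>x\<in>X. R x y"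
    and square: "\<And>x x' y y'. \<lbrakk>x \<in> A; x' \<in> A; x \<noteq> x'; y \<in> B; y' \<in> B; y \<noteq> y'\<rbrakk>
      \<Longrightarrow> R x y \<or> R x y' \<or> R x' y \<or> R x' y'"
  shows "rel_pmf R (pmf_of_set A) (pmf_of_set B)"
proof -
  define SA where "SA = {X. X \<subseteq> A \<and> card X = 3}"
  define SB where "SB = {Y. Y \<subseteq> B \<and> card Y = 3}"
  have fin: "finite SA" "finite SB"
    using A(1) B(1) by (simp_all add: SA_def SB_def)
  obtain X0 where "X0 \<subseteq> A" "card X0 = 3"
    using A(2) by (rule obtain_subset_with_card_n)
  moreover obtain Y0 where "Y0 \<subseteq> B" "card Y0 = 3"
    using B(2) by (rule obtain_subset_with_card_n)
  ultimately have "X0 \<in> SA" "Y0 \<in> SB"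
    by (simp_all add: SA_def SB_def)
  then have ne: "SA \<noteq> {}" "SB \<noteq> {}"
    by blast+
  \<comment> \<open>The two subsets are drawn independently, since every pair of them admits a
    matching.\<close>
  have "rel_pmf (\<lambda>X Y. X \<in> SA \<and> Y \<in> SB) (pmf_of_set SA) (pmf_of_set SB)"
    using fin ne
    by (intro rel_pmf.intros[where pq = "pair_pmf (pmf_of_set SA) (pmf_of_set SB)"])
      (simp_all add: map_fst_pair_pmf map_snd_pair_pmf)
  then have "rel_pmf R (pmf_of_set SA \<bind> pmf_of_set) (pmf_of_set SB \<bind> pmf_of_set)"
  proof (rule rel_pmf_bindI)
    fix X Y assume "X \<in> SA \<and> Y \<in> SB"
    then have X: "X \<subseteq> A" "card X = 3" and Y: "Y \<subseteq> B" "card Y = 3"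
      by (simp_all add: SA_def SB_def)
    show "rel_pmf R (pmf_of_set X) (pmf_of_set Y)"
    proof (rule rel_pmf_of_set_three_Hall[OF X(2) Y(2)])
      show "\<exists>y\<in>Y. R x y" if "x \<in> X" for x
        using row that X(1) Y by blast
      show "\<exists>x\<in>X. R x y" if "y \<in> Y" for y
        using col that X Y(1) by blast
      show "R x y \<or> R x y' \<or> R x' y \<or> R x' y'"
        if "x \<in> X" "x' \<in> X" "x \<noteq> x'" "y \<in> Y" "y' \<in> Y" "y \<noteq> y'" for x x' y y'
        using square[of x x' y y'] that X(1) Y(1) by blast
    qed
  qed
  then show ?thesis
    using A B pmf_of_set_via_subsets[of A 3] pmf_of_set_via_subsets[of B 3]
    unfolding SA_def SB_def by simp
qed

section \<open>Close pairs of vertices in a square-free graph\<close>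

context simple_graph
begin

lemma edge_commute: "{x, y} \<in> E \<longleftrightarrow> {y, x} \<in> E"
  by (simp add: insert_commute)

lemma edgeD:
  assumes "{x, y} \<in> E"
  shows "x \<in> V" and "y \<in> V" and "x \<noteq> y"
  using edges[OF assms] by auto

text \<open>Consecutive vertices of a closed 4-walk differ because there are no loops, so only the
  two diagonals can coincide.\<close>

lemma no_square:
  assumes "square_free V E" and "{p, q} \<in> E" and "{q, r} \<in> E" and "{r, s} \<in> E" and "{s, p} \<in> E"
  shows "p = r \<or> q = s"
proof (rule ccontr)
  assume "\<not> (p = r \<or> q = s)"
  then have "distinct [p, q, r, s]"
    using assms(2-5)[THEN edgeD(3)] by auto
  then show False
    using assms(1)[unfolded square_free_def, rule_format, of p q r s]
      assms(2-5) assms(2-5)[THEN edgeD(1)] by simp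
qed

text \<open>At most one element of \<open>Y\<close> equals \<open>x\<close>. If all the others were
  adjacent to \<open>x\<close>, two of them, \<open>y\<close> and \<open>y'\<close>, would form the
  square \<open>x\<close>, \<open>y\<close>, \<open>b\<close>, \<open>y'\<close>.\<close>

lemma no_close_triple:
  assumes "square_free V E" and "x \<noteq> b" and "Y \<subseteq> neighbours V E b" and "card Y = 3"
  shows "\<exists>y\<in>Y. x \<noteq> y \<and> {x, y} \<notin> E"
proof (rule ccontr)
  assume "\<not> ?thesis"
  then have close: "y = x \<or> {x, y} \<in> E" if "y \<in> Y" for y
    using that by auto
  have "card (Y - {x}) \<ge> 2"
    using assms(4) by (simp add: card_Diff_singleton_if)
  then obtain Z where Z: "Z \<subseteq> Y - {x}" "card Z = 2"
    by (rule obtain_subset_with_card_n)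
  then obtain y y' where yy: "y \<noteq> y'" "Z = {y, y'}"
    by (meson card_2_iff)
  then have "{x, y} \<in> E" "{x, y'} \<in> E" "{y, b} \<in> E" "{y', b} \<in> E"
    using Z(1) close assms(3) by (auto simp: neighbours_def)
  then show False
    using no_square[OF assms(1), of x y b y'] assms(2) yy(1) edge_commute by blast
qed

text \<open>If no \<open>x\<close> coincides with a \<open>y\<close>, then \<open>x\<close>,
  \<open>y\<close>, \<open>x'\<close>, \<open>y'\<close> is itself a square. A coincidence produces
  a common neighbour of \<open>a\<close> and \<open>b\<close>, and then a square through
  \<open>a\<close>.\<close>

lemma no_close_square:
  assumes sf: "square_free V E" and ab: "a \<noteq> b" "{a, b} \<notin> E"
    and x: "{x, a} \<in> E" "{x', a} \<in> E" "x \<noteq> x'"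
    and y: "{y, b} \<in> E" "{y', b} \<in> E" "y \<noteq> y'"
    and c: "x = y \<or> {x, y} \<in> E" "x = y' \<or> {x, y'} \<in> E"
      "x' = y \<or> {x', y} \<in> E" "x' = y' \<or> {x', y'} \<in> E"
  shows False
proof -
  \<comment> \<open>Here \<open>z\<close> is the vertex at which some \<open>x\<close> and some
    \<open>y\<close> coincide, and \<open>p\<close>, \<open>q\<close> are the other neighbours of
    \<open>a\<close> and \<open>b\<close>. If \<open>p = q\<close>, the square is \<open>a\<close>,
    \<open>z\<close>, \<open>b\<close>, \<open>p\<close>; otherwise it is \<open>a\<close>,
    \<open>z\<close>, \<open>q\<close>, \<open>p\<close>, where \<open>q\<close> differs from
    \<open>a\<close> because \<open>q\<close> is adjacent to \<open>b\<close> and \<open>a\<close>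
    is not.\<close>
  have common: False
    if "{z, a} \<in> E" "{z, b} \<in> E" "{p, a} \<in> E" "{q, b} \<in> E" "p \<noteq> z"
      "{z, q} \<in> E" "p = q \<or> {p, q} \<in> E" for z p q
  proof (cases "p = q")
    case True
    with no_square[OF sf, of a z b p] that ab show False
      by (simp add: insert_commute)
  next
    case False
    with no_square[OF sf, of a z q p] that ab show False
      by (auto simp: insert_commute)
  qed
  have "x \<noteq> y"
    using common[of x x' y'] x y c by metis
  moreover have "x \<noteq> y'"
    using common[of x x' y] x y c by metis
  moreover have "x' \<noteq> y"
    using common[of x' x y'] x y c by metis
  moreover have "x' \<noteq> y'"
    using common[of x' x y] x y c by metis
  ultimately show False
    using no_square[OF sf, of x y x' y'] x(3) y(3) c edge_commute by metis
qed

text \<open>One step of the coupling: non-adjacency of \<open>a\<close> and \<open>b\<close> keeps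
  \<open>b\<close> out of the neighbourhood of \<open>a\<close> and vice versa, so
  \<open>no_close_triple\<close> excludes the 1-by-3 and 3-by-1 blocks, and
  \<open>no_close_square\<close> the 2-by-2 blocks.\<close>

lemma avoiding_step:
  assumes sf: "square_free V E" and ab: "a \<noteq> b" "{a, b} \<notin> E"
    and deg: "finite V" "deg V E a \<ge> 3" "deg V E b \<ge> 3"
  shows "rel_pmf (\<lambda>x y. x \<noteq> y \<and> {x, y} \<notin> E)
    (pmf_of_set (neighbours V E a)) (pmf_of_set (neighbours V E b))"
proof (rule rel_pmf_of_set_sparse_complement)
  show "finite (neighbours V E a)" "finite (neighbours V E b)"
    using deg(1) by (simp_all add: neighbours_def)
  show "card (neighbours V E a) \<ge> 3" "card (neighbours V E b) \<ge> 3"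
    using deg by (simp_all add: deg_def)
next
  fix x Y assume xY: "x \<in> neighbours V E a" "Y \<subseteq> neighbours V E b" "card Y = 3"
  then have "x \<noteq> b"
    using ab(2) by (auto simp: neighbours_def insert_commute)
  then show "\<exists>y\<in>Y. x \<noteq> y \<and> {x, y} \<notin> E"
    using no_close_triple[OF sf] xY(2,3) by simp
next
  fix X y assume Xy: "X \<subseteq> neighbours V E a" "card X = 3" "y \<in> neighbours V E b"
  then have "y \<noteq> a"
    using ab(2) by (auto simp: neighbours_def)
  then obtain x where "x \<in> X" "y \<noteq> x \<and> {y, x} \<notin> E"
    using no_close_triple[OF sf] Xy(1,2) by blast
  then show "\<exists>x\<in>X. x \<noteq> y \<and> {x, y} \<notin> E"
    using edge_commute[of x y] by (intro bexI[of _ x]) auto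
next
  fix x x' y y'
  assume "x \<in> neighbours V E a" "x' \<in> neighbours V E a" "x \<noteq> x'"
    "y \<in> neighbours V E b" "y' \<in> neighbours V E b" "y \<noteq> y'"
  then show "(x \<noteq> y \<and> {x, y} \<notin> E) \<or> (x \<noteq> y' \<and> {x, y'} \<notin> E)
    \<or> (x' \<noteq> y \<and> {x', y} \<notin> E) \<or> (x' \<noteq> y' \<and> {x', y'} \<notin> E)"
    using no_close_square[OF sf ab, of x x' y y'] unfolding neighbours_def by blast
qed

text \<open>Supplies the initial state. Among three neighbours \<open>x\<close>, \<open>y\<close>,
  \<open>z\<close> of a vertex \<open>v\<close>, edges \<open>{x, y}\<close> and
  \<open>{y, z}\<close> together would close the square \<open>v\<close>, \<open>x\<close>,
  \<open>y\<close>, \<open>z\<close>.\<close>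

lemma nonadjacent_pair:
  assumes sf: "square_free V E" and "finite V" and "\<And>v. v \<in> V \<Longrightarrow> deg V E v \<ge> 3"
  obtains a b where "a \<in> V" "b \<in> V" "a \<noteq> b" "{a, b} \<notin> E"
proof -
  obtain v where "v \<in> V"
    using nonempty by auto
  with assms(3) have "3 \<le> card (neighbours V E v)"
    by (simp add: deg_def)
  then obtain X where "X \<subseteq> neighbours V E v" "card X = 3"
    by (rule obtain_subset_with_card_n)
  then obtain x y z where *: "{x, y, z} \<subseteq> neighbours V E v" "x \<noteq> y" "y \<noteq> z" "x \<noteq> z"
    by (metis card_3_iff)
  then have "{x, v} \<in> E" "{y, v} \<in> E" "{z, v} \<in> E" "x \<in> V" "y \<in> V" "z \<in> V"
    by (auto simp: neighbours_def)
  moreover have "\<not> ({x, y} \<in> E \<and> {y, z} \<in> E)"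
    using no_square[OF sf, of v x y z] *(4) calculation edgeD(3)[of y v] edge_commute by metis
  ultimately show ?thesis
    using that[of x y] that[of y z] *(2,3) by blast
qed

end

section \<open>Finite Markov chains on path space: projections and existence\<close>

text \<open>The Markov property is in product form, so that histories of probability zero need no
  separate treatment; a history \<open>h\<close> that leaves \<open>G\<close> by time
  \<open>t\<close> gives zero on both sides. The initial law is left free.\<close>

locale finite_chain = prob_space M
  for M :: "(nat \<Rightarrow> 's) measure" and G :: "'s set" and K :: "'s \<Rightarrow> 's pmf" +
  assumes finite_states: "finite G"
    and state_measurable: "\<And>t. (\<lambda>\<omega>. \<omega> t) \<in> measurable M (count_space G)"
    and transition: "\<And>t h C. \<P>(\<omega> in M. (\<forall>s\<le>t. \<omega> s = h s) \<and> \<omega> (Suc t) \<in> C) =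
      \<P>(\<omega> in M. \<forall>s\<le>t. \<omega> s = h s) * measure_pmf.prob (K (h t)) C"
    and steps_in_support: "AE \<omega> in M. \<forall>t. \<omega> (Suc t) \<in> set_pmf (K (\<omega> t))"
begin

lemma state_in: "\<omega> \<in> space M \<Longrightarrow> \<omega> t \<in> G"
  using measurable_space[OF state_measurable] by simp

lemma state_event: "{\<omega> \<in> space M. \<omega> t \<in> C} \<in> sets M"
proof -
  have "{\<omega> \<in> space M. \<omega> t \<in> C} = (\<lambda>\<omega>. \<omega> t) -` (C \<inter> G) \<inter> space M"
    using state_in by auto
  then show ?thesis
    using measurable_sets[OF state_measurable, of "C \<inter> G" t] by simp
qed

lemma prefix_event: "{\<omega> \<in> space M. (\<forall>s\<le>t. \<omega> s = h s) \<and> \<omega> (Suc t) \<in> C} \<in> sets M"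
proof -
  have "{\<omega> \<in> space M. \<forall>s\<in>{..t}. \<omega> s \<in> {h s}} \<in> sets M"
    by (intro sets.sets_Collect_finite_All' state_event) auto
  then have "{\<omega> \<in> space M. \<forall>s\<in>{..t}. \<omega> s \<in> {h s}} \<inter> {\<omega> \<in> space M. \<omega> (Suc t) \<in> C} \<in> sets M"
    using state_event by blast
  also have "{\<omega> \<in> space M. \<forall>s\<in>{..t}. \<omega> s \<in> {h s}} \<inter> {\<omega> \<in> space M. \<omega> (Suc t) \<in> C} =
    {\<omega> \<in> space M. (\<forall>s\<le>t. \<omega> s = h s) \<and> \<omega> (Suc t) \<in> C}"
    by auto
  finally show ?thesis .
qed

text \<open>The hypothesis says that \<phi> looks only at times up to \<open>t\<close>. As
  \<open>G\<close> is finite, there are finitely many prefixes, and the extensional functions in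
  \<open>{..t} \<rightarrow>\<^sub>E G\<close> list each of them once, which makes the union
  disjoint.\<close>

lemma prob_history_decomp:
  assumes "\<And>\<omega>. \<phi> (restrict \<omega> {..t}) \<longleftrightarrow> \<phi> \<omega>"
  shows "\<P>(\<omega> in M. \<phi> \<omega> \<and> \<omega> (Suc t) \<in> C) =
    (\<Sum>h \<in> {h \<in> {..t} \<rightarrow>\<^sub>E G. \<phi> h}. \<P>(\<omega> in M. (\<forall>s\<le>t. \<omega> s = h s) \<and> \<omega> (Suc t) \<in> C))"
proof -
  let ?H = "{h \<in> {..t} \<rightarrow>\<^sub>E G. \<phi> h}"
  let ?P = "\<lambda>h. {\<omega> \<in> space M. (\<forall>s\<le>t. \<omega> s = h s) \<and> \<omega> (Suc t) \<in> C}"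
  have eq: "restrict \<omega> {..t} = h" if "h \<in> ?H" "\<forall>s\<le>t. \<omega> s = h s" for h \<omega>
    using that by (intro ext) (auto simp: PiE_def extensional_def)
  have "{\<omega> \<in> space M. \<phi> \<omega> \<and> \<omega> (Suc t) \<in> C} = (\<Union>h\<in>?H. ?P h)"
  proof (intro equalityI subsetI)
    fix \<omega> assume \<omega>: "\<omega> \<in> {\<omega> \<in> space M. \<phi> \<omega> \<and> \<omega> (Suc t) \<in> C}"
    then have "restrict \<omega> {..t} \<in> ?H"
      using assms state_in by auto
    moreover have "\<omega> \<in> ?P (restrict \<omega> {..t})"
      using \<omega> by simp
    ultimately show "\<omega> \<in> (\<Union>h\<in>?H. ?P h)"
      by blast
  next
    fix \<omega> assume "\<omega> \<in> (\<Union>h\<in>?H. ?P h)"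
    then obtain h where h: "h \<in> ?H" "\<omega> \<in> ?P h"
      by blast
    then have "restrict \<omega> {..t} = h"
      using eq by simp
    with h show "\<omega> \<in> {\<omega> \<in> space M. \<phi> \<omega> \<and> \<omega> (Suc t) \<in> C}"
      using assms[of \<omega>] by simp
  qed
  moreover have "prob (\<Union>h\<in>?H. ?P h) = (\<Sum>h\<in>?H. prob (?P h))"
  proof (rule finite_measure_finite_Union)
    show "finite ?H"
      using finite_states by (simp add: finite_PiE)
    show "?P ` ?H \<subseteq> events"
      using prefix_event by blast
    show "disjoint_family_on ?P ?H"
      unfolding disjoint_family_on_def
    proof (intro ballI impI equals0I)
      fix h h' \<omega> assume "h \<in> ?H" "h' \<in> ?H" "h \<noteq> h'" "\<omega> \<in> ?P h \<inter> ?P h'"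
      then have "restrict \<omega> {..t} = h" "restrict \<omega> {..t} = h'"
        using eq by blast+
      with \<open>h \<noteq> h'\<close> show False
        by simp
    qed
  qed
  ultimately show ?thesis
    by simp
qed

text \<open>If the chance of moving into \<open>C\<close> is the same \<open>q\<close> from every
  state compatible with \<phi>, then summing over full histories lets \<open>q\<close> be factored
  out. Hence coarser information than the full history gives the same transition
  probability.\<close>

lemma history_transition:
  assumes \<phi>: "\<And>\<omega>. \<phi> (restrict \<omega> {..t}) \<longleftrightarrow> \<phi> \<omega>"
    and q: "\<And>h. \<phi> h \<Longrightarrow> h t \<in> G \<Longrightarrow> measure_pmf.prob (K (h t)) C = q"
  shows "\<P>(\<omega> in M. \<phi> \<omega> \<and> \<omega> (Suc t) \<in> C) = \<P>(\<omega> in M. \<phi> \<omega>) * q"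
proof -
  let ?H = "{h \<in> {..t} \<rightarrow>\<^sub>E G. \<phi> h}"
  have "\<P>(\<omega> in M. \<phi> \<omega> \<and> \<omega> (Suc t) \<in> C) = (\<Sum>h\<in>?H. \<P>(\<omega> in M. \<forall>s\<le>t. \<omega> s = h s) * q)"
    unfolding prob_history_decomp[where \<phi> = \<phi>, OF \<phi>]
  proof (rule sum.cong)
    fix h assume "h \<in> ?H"
    then have "measure_pmf.prob (K (h t)) C = q"
      by (intro q) auto
    then show "\<P>(\<omega> in M. (\<forall>s\<le>t. \<omega> s = h s) \<and> \<omega> (Suc t) \<in> C) =
      \<P>(\<omega> in M. \<forall>s\<le>t. \<omega> s = h s) * q"
      by (simp only: transition)
  qed simp
  also have "\<dots> = (\<Sum>h\<in>?H. \<P>(\<omega> in M. \<forall>s\<le>t. \<omega> s = h s)) * q"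
    by (simp only: sum_distrib_right)
  \<comment> \<open>With \<open>C = UNIV\<close> the decomposition puts the prefix probabilities
    back together.\<close>
  also have "(\<Sum>h\<in>?H. \<P>(\<omega> in M. \<forall>s\<le>t. \<omega> s = h s)) = \<P>(\<omega> in M. \<phi> \<omega>)"
    using prob_history_decomp[where \<phi> = \<phi> and C = UNIV, OF \<phi>] by simp
  finally show ?thesis .
qed

text \<open>The law of \<open>f\<close> after one step from \<open>s\<close> depends on
  \<open>s\<close> only through \<open>f s\<close>, so the image process is Markov in its own
  history although \<open>f\<close> forgets part of the state.\<close>

lemma simple_random_walk_projection:
  assumes "finite V"
    and f: "\<And>s. s \<in> G \<Longrightarrow> f s \<in> V"
      "\<And>s. s \<in> G \<Longrightarrow> neighbours V E (f s) \<noteq> {}"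
      "\<And>s. s \<in> G \<Longrightarrow> map_pmf f (K s) = pmf_of_set (neighbours V E (f s))"
  shows "simple_random_walk V E M (\<lambda>t \<omega>. f (\<omega> t))"
proof -
  let ?q = "\<lambda>v u. if u \<in> neighbours V E v then 1 / real (deg V E v) else 0"
  have K: "measure_pmf.prob (K s) {c. f c = u} = ?q (f s) u" if "s \<in> G" for s u
  proof -
    have "measure_pmf.prob (K s) {c. f c = u} = pmf (map_pmf f (K s)) u"
      by (simp add: pmf_map vimage_def)
    also have "\<dots> = ?q (f s) u"
      using f(2,3)[OF that] \<open>finite V\<close> by (simp add: neighbours_def deg_def)
    finally show ?thesis .
  qed
  \<comment> \<open>Here \<phi> may be any event of the past that fixes the current value of
    \<open>f\<close>. It is used for the present value alone and for the whole history of
    \<open>f\<close>; the Markov property is the agreement of the two results.\<close>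
  have cond: "\<P>(\<omega> in M. f (\<omega> (Suc t)) = u \<bar> \<phi> \<omega>) = ?q v u"
    if "\<And>\<omega>. \<phi> (restrict \<omega> {..t}) \<longleftrightarrow> \<phi> \<omega>" "\<And>\<omega>. \<phi> \<omega> \<Longrightarrow> f (\<omega> t) = v"
      "\<P>(\<omega> in M. \<phi> \<omega>) > 0" for t u v \<phi>
    using history_transition[where \<phi> = \<phi> and t = t and C = "{c. f c = u}" and q = "?q v u"] that K
    by (simp add: cond_prob_def conj_commute)
  have single: "\<P>(\<omega> in M. f (\<omega> (Suc t)) = u \<bar> f (\<omega> t) = v) = ?q v u"
    if "\<P>(\<omega> in M. f (\<omega> t) = v) > 0" for t u v
    using that by (intro cond) simp_all
  have history: "\<P>(\<omega> in M. f (\<omega> (Suc t)) = u \<bar> \<forall>s\<le>t. f (\<omega> s) = x s) = ?q (x t) u"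
    if "\<P>(\<omega> in M. \<forall>s\<le>t. f (\<omega> s) = x s) > 0" for t u x
    using that by (intro cond) simp_all
  have meas: "(\<lambda>\<omega>. f (\<omega> t)) \<in> measurable M (count_space V)" for t
    using f(1) by (intro measurable_compose[OF state_measurable]) simp
  \<comment> \<open>A history of positive probability ends in a value of positive probability, as
    \<open>single\<close> demands.\<close>
  have pos: "\<P>(\<omega> in M. f (\<omega> t) = x t) > 0"
    if "\<P>(\<omega> in M. \<forall>s\<le>t. f (\<omega> s) = x s) > 0" for t x
  proof -
    have "\<P>(\<omega> in M. \<forall>s\<le>t. f (\<omega> s) = x s) \<le> \<P>(\<omega> in M. f (\<omega> t) = x t)"
      using state_event[of t "{c. f c = x t}"] by (intro finite_measure_mono) auto
    with that show ?thesis
      by linarith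
  qed
  show ?thesis
    unfolding simple_random_walk_def markov_chain_def
    using prob_space_axioms meas single history pos by simp
qed

end

text \<open>The chain is driven by independent random self-maps of the state space, so that fixing a
  finite piece of trajectory is a cylinder condition on the maps.\<close>

lemma finite_chain_exists:
  fixes K :: "'s \<Rightarrow> 's pmf"
  assumes G: "finite G" "s0 \<in> G" and K: "\<And>s. s \<in> G \<Longrightarrow> set_pmf (K s) \<subseteq> G"
  obtains M where "finite_chain M G K"
proof -
  \<comment> \<open>The law of a random map whose values at the states \<open>s\<close> in
    \<open>G\<close> are independent with laws \<open>K s\<close>; outside \<open>G\<close> the map
    takes the default value \<open>s0\<close>.\<close>
  define Q where "Q = Pi_pmf G s0 K"
  \<comment> \<open>Restricting to this set of full measure makes every path, not just almost every
    one, stay in \<open>G\<close> and take only steps in the support of \<open>K\<close>.\<close>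
  define W where "W = {f. \<forall>s\<in>G. f s \<in> set_pmf (K s)}"
  define N where "N = restrict_space (measure_pmf Q) W"
  define P where "P = PiM (UNIV :: nat set) (\<lambda>_. N)"
  define path where "path = (\<lambda>\<omega> t. rec_nat s0 (\<lambda>t s. \<omega> t s) t)"
  have path_simps: "path \<omega> 0 = s0" "path \<omega> (Suc t) = \<omega> t (path \<omega> t)" for \<omega> t
    by (simp_all add: path_def)

  have QW: "set_pmf Q \<subseteq> W"
    using G(1) by (auto simp: Q_def W_def set_Pi_pmf PiE_dflt_def)
  have space_N: "space N = W" and sets_N: "X \<in> sets N \<longleftrightarrow> X \<subseteq> W" for X
    by (auto simp: N_def space_restrict_space sets_restrict_space)
  interpret N: prob_space N
    unfolding N_def using QW
    by (intro prob_space_restrict_space measure_pmf.emeasure_eq_1_AE) (auto simp: AE_measure_pmf_iff)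
  interpret product_prob_space "\<lambda>_. N" "UNIV :: nat set"
    by unfold_locales
  have N_prob: "measure N {f \<in> W. f s \<in> C} = measure_pmf.prob (K s) C" if "s \<in> G" for s C
  proof -
    have "measure N {f \<in> W. f s \<in> C} = measure_pmf.prob Q {f \<in> W. f s \<in> C}"
      unfolding N_def by (intro measure_restrict_space) auto
    also have "\<dots> = measure_pmf.prob Q {f. f s \<in> C}"
      using QW by (intro measure_pmf.finite_measure_eq_AE) (auto simp: AE_measure_pmf_iff)
    also have "\<dots> = measure_pmf.prob (map_pmf (\<lambda>f. f s) Q) C"
      by (simp add: vimage_def)
    also have "\<dots> = measure_pmf.prob (K s) C"
      using G(1) that by (simp add: Q_def Pi_pmf_component)
    finally show ?thesis .
  qed

  have P_W: "\<omega> t \<in> W" if "\<omega> \<in> space P" for \<omega> t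
    using that by (auto simp: P_def space_PiM space_N)
  have path_in: "path \<omega> t \<in> G" if "\<omega> \<in> space P" for \<omega> t
  proof (induction t)
    case (Suc t)
    then show ?case
      using P_W[OF that, of t] K by (auto simp: path_simps W_def)
  qed (simp add: path_simps G(2))
  have path_step: "path \<omega> (Suc t) \<in> set_pmf (K (path \<omega> t))" if "\<omega> \<in> space P" for \<omega> t
    using P_W[OF that, of t] path_in[OF that, of t] by (auto simp: path_simps W_def)

  have eval_meas: "(\<lambda>f. f s) \<in> measurable N (count_space G)" if "s \<in> G" for s
    using that K by (auto simp: measurable_def space_N sets_N W_def)
  have path_meas: "(\<lambda>\<omega>. path \<omega> t) \<in> measurable P (count_space G)" for t
  proof (induction t)
    case 0
    then show ?case
      by (simp add: path_simps G(2))
  next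
    case (Suc t)
    \<comment> \<open>The map at time \<open>t\<close> is evaluated at a random state; since there
      are finitely many states, measurability at each fixed state suffices.\<close>
    have "(\<lambda>\<omega>. \<omega> t s) \<in> measurable P (count_space G)" if "s \<in> G" for s
      unfolding P_def
      by (rule measurable_compose[OF measurable_component_singleton[where i = t] eval_meas[OF that]])
        simp
    then show ?case
      unfolding path_simps
      by (rule measurable_compose_countable'[where f = "\<lambda>s \<omega>. \<omega> t s", OF _ Suc countable_finite[OF G(1)]])
  qed

  have P_prob: "measure P {\<omega> \<in> space P. (\<forall>s\<le>t. path \<omega> s = h s) \<and> path \<omega> (Suc t) \<in> C} =
      (\<Prod>i<t. measure_pmf.prob (K (h i)) {h (Suc i)}) * measure_pmf.prob (K (h t)) C"
    if h: "h 0 = s0" "\<forall>s\<le>t. h s \<in> G" for t h C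
  proof -
    \<comment> \<open>The map at time \<open>i\<close> produces the state at time
      \<open>i + 1\<close>, so the maps at times 0 to \<open>t\<close> decide the whole event: those
      before \<open>t\<close> must follow \<open>h\<close>, and the one at \<open>t\<close> must
      lead into \<open>C\<close>.\<close>
    define X where "X = (\<lambda>i. {f \<in> W. f (h i) \<in> (if i = t then C else {h (Suc i)})})"
    have prefix: "(\<forall>s\<le>n. path \<omega> s = h s) \<longleftrightarrow> (\<forall>i<n. \<omega> i (h i) = h (Suc i))" for \<omega> n
    proof (induction n)
      case (Suc n)
      then show ?case
        by (auto simp: le_Suc_eq less_Suc_eq path_simps)
    qed (simp add: path_simps h(1))
    have "(\<forall>s\<le>t. path \<omega> s = h s) \<and> path \<omega> (Suc t) \<in> C \<longleftrightarrow> (\<forall>i\<in>{..t}. \<omega> i \<in> X i)"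
      if "\<omega> \<in> space P" for \<omega>
    proof -
      have path_t: "path \<omega> t = h t" if "\<forall>i<t. \<omega> i (h i) = h (Suc i)"
        using prefix[of t \<omega>] that by simp
      have "(\<forall>s\<le>t. path \<omega> s = h s) \<and> path \<omega> (Suc t) \<in> C \<longleftrightarrow>
          (\<forall>i<t. \<omega> i (h i) = h (Suc i)) \<and> \<omega> t (h t) \<in> C"
        using path_t unfolding prefix path_simps(2) by auto
      also have "\<dots> \<longleftrightarrow> (\<forall>i\<in>{..t}. \<omega> i \<in> X i)"
        using P_W[OF that] by (auto simp: X_def le_less)
      finally show ?thesis .
    qed
    then have "{\<omega> \<in> space P. (\<forall>s\<le>t. path \<omega> s = h s) \<and> path \<omega> (Suc t) \<in> C} =
        {\<omega> \<in> space P. \<forall>i\<in>{..t}. \<omega> i \<in> X i}"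
      by blast
    also have "\<dots> = emb UNIV {..t} (Pi\<^sub>E {..t} X)"
      by (auto simp: prod_emb_def P_def space_PiM Pi_iff)
    also have "measure P \<dots> = (\<Prod>i\<le>t. measure N (X i))"
      unfolding P_def by (intro measure_PiM_emb) (auto simp: sets_N X_def)
    also have "\<dots> = (\<Prod>i\<le>t. measure_pmf.prob (K (h i)) (if i = t then C else {h (Suc i)}))"
      using h(2) by (intro prod.cong) (auto simp only: X_def N_prob atMost_iff)
    also have "\<dots> = (\<Prod>i<t. measure_pmf.prob (K (h i)) {h (Suc i)}) * measure_pmf.prob (K (h t)) C"
      by (simp add: lessThan_Suc_atMost[symmetric])
    finally show ?thesis .
  qed
  have P_transition: "\<P>(\<omega> in P. (\<forall>s\<le>t. path \<omega> s = h s) \<and> path \<omega> (Suc t) \<in> C) =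
      \<P>(\<omega> in P. \<forall>s\<le>t. path \<omega> s = h s) * measure_pmf.prob (K (h t)) C" for t h C
  proof (cases "h 0 = s0 \<and> (\<forall>s\<le>t. h s \<in> G)")
    case True
    \<comment> \<open>Taking \<open>C = UNIV\<close> identifies the product over
      \<open>i < t\<close> as the probability of the history.\<close>
    then show ?thesis
      using P_prob[of h t C] P_prob[of h t UNIV] by simp
  next
    case False
    have "\<not> (\<forall>s\<le>t. path \<omega> s = h s)" if "\<omega> \<in> space P" for \<omega>
      using False path_in[OF that] path_simps(1) by (metis le0)
    then have "{\<omega> \<in> space P. (\<forall>s\<le>t. path \<omega> s = h s) \<and> path \<omega> (Suc t) \<in> C} = {}"
      "{\<omega> \<in> space P. \<forall>s\<le>t. path \<omega> s = h s} = {}"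
      by blast+
    then show ?thesis
      by (simp only: measure_empty mult_zero_left)
  qed

  \<comment> \<open>So far the sample points are sequences of maps; the law of \<open>path\<close>
    is now transported to sequences of states.\<close>
  define S where "S = PiM (UNIV :: nat set) (\<lambda>_. count_space G)"
  define M where "M = distr P S path"
  have path_S: "path \<in> measurable P S"
    unfolding S_def using path_meas path_in by (intro measurable_PiM_single') auto
  have comp: "(\<lambda>\<omega>. \<omega> t) \<in> measurable M (count_space G)" for t
    unfolding M_def S_def by simp
  have comp_event: "{\<omega> \<in> space S. \<omega> t \<in> C} \<in> sets S" for t C
  proof -
    have "{\<omega> \<in> space S. \<omega> t \<in> C} = (\<lambda>\<omega>. \<omega> t) -` (C \<inter> G) \<inter> space S"
      by (auto simp: S_def space_PiM)
    also have "\<dots> \<in> sets S"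
      unfolding S_def by (rule measurable_sets[OF measurable_component_singleton]) auto
    finally show ?thesis .
  qed
  have pull: "\<P>(\<omega> in M. \<phi> \<omega>) = \<P>(\<omega> in P. \<phi> (path \<omega>))" if "{\<omega> \<in> space S. \<phi> \<omega>} \<in> sets S" for \<phi>
  proof -
    have "path -` {\<omega> \<in> space S. \<phi> \<omega>} \<inter> space P = {\<omega> \<in> space P. \<phi> (path \<omega>)}"
      using measurable_space[OF path_S] by blast
    then show ?thesis
      using measure_distr[OF path_S that] by (simp add: M_def)
  qed
  have prefix_S: "{\<omega> \<in> space S. \<forall>s\<in>{..t}. \<omega> s \<in> {h s}} \<in> sets S" for t h
    by (intro sets.sets_Collect_finite_All' comp_event) auto
  have "\<P>(\<omega> in M. (\<forall>s\<le>t. \<omega> s = h s) \<and> \<omega> (Suc t) \<in> C) =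
      \<P>(\<omega> in M. \<forall>s\<le>t. \<omega> s = h s) * measure_pmf.prob (K (h t)) C" for t h C
  proof -
    have 1: "{\<omega> \<in> space S. \<forall>s\<le>t. \<omega> s = h s} \<in> sets S"
      using prefix_S[of t h] by (simp only: Ball_def atMost_iff singleton_iff)
    have 2: "{\<omega> \<in> space S. (\<forall>s\<le>t. \<omega> s = h s) \<and> \<omega> (Suc t) \<in> C} \<in> sets S"
      by (rule sets.sets_Collect_conj[OF comp_event 1])
    show ?thesis
      unfolding pull[OF 1] pull[OF 2] by (rule P_transition)
  qed
  moreover have "AE \<omega> in M. \<forall>t. \<omega> (Suc t) \<in> set_pmf (K (\<omega> t))"
  proof -
    have "AE \<omega> in M. \<omega> (Suc t) \<in> set_pmf (K (\<omega> t))" for t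
    proof -
      \<comment> \<open>Splitting by the current state shows that the event is measurable, which is
        needed to pull the almost sure statement back along \<open>path\<close>.\<close>
      have "{\<omega> \<in> space S. \<omega> (Suc t) \<in> set_pmf (K (\<omega> t))} =
          (\<Union>s\<in>G. {\<omega> \<in> space S. \<omega> t \<in> {s}} \<inter> {\<omega> \<in> space S. \<omega> (Suc t) \<in> set_pmf (K s)})"
        by (auto simp: S_def space_PiM)
      also have "\<dots> \<in> sets S"
        using G(1) by (intro sets.finite_UN sets.Int comp_event)
      finally show ?thesis
        unfolding M_def using path_step by (simp add: AE_distr_iff[OF path_S])
    qed
    then show ?thesis
      by (simp add: AE_all_countable)
  qed
  moreover have "prob_space M"
    unfolding M_def by (rule prob_space.prob_space_distr[OF _ path_S]) (simp add: P_def prob_space_axioms)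
  ultimately have "finite_chain M G K"
    using G(1) comp by (simp add: finite_chain_def finite_chain_axioms_def)
  then show thesis
    by (rule that)
qed

section \<open>Assembling the avoidance coupling\<close>

theorem theorem1p4:
  fixes V :: "'a set" and E :: "'a set set"
  assumes "simple_graph V E"
    and "finite V"
    and "square_free V E"
    and "min_degree V E \<ge> 3"
  shows "has_avoidance_coupling V E"
proof -
  interpret simple_graph V E
    by fact
  have deg: "deg V E v \<ge> 3" if "v \<in> V" for v
    using assms(4) cINF_lower[OF bdd_below_bot that, of "deg V E"] by (simp add: min_degree_def)
  define G where "G = {(a, b). a \<in> V \<and> b \<in> V \<and> a \<noteq> b \<and> {a, b} \<notin> E}"
  have "finite G"
    by (rule finite_subset[of _ "V \<times> V"]) (auto simp: G_def assms(2))
  have nb: "neighbours V E v \<noteq> {}" "finite (neighbours V E v)" if "v \<in> V" for v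
  proof -
    have "0 < card (neighbours V E v)"
      using deg[OF that] by (simp add: deg_def)
    then show "neighbours V E v \<noteq> {}" "finite (neighbours V E v)"
      by (metis card_gt_0_iff)+
  qed
  have "\<exists>p. (\<forall>(x, y) \<in> set_pmf p. x \<noteq> y \<and> {x, y} \<notin> E) \<and>
      map_pmf fst p = pmf_of_set (neighbours V E (fst s)) \<and>
      map_pmf snd p = pmf_of_set (neighbours V E (snd s))" (is "\<exists>p. ?coupling s p") if "s \<in> G" for s
  proof -
    have "rel_pmf (\<lambda>x y. x \<noteq> y \<and> {x, y} \<notin> E)
        (pmf_of_set (neighbours V E (fst s))) (pmf_of_set (neighbours V E (snd s)))"
      using that deg by (intro avoiding_step assms) (auto simp: G_def)
    then show ?thesis
      by (auto elim!: rel_pmf.cases)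
  qed
  \<comment> \<open>One coupling is chosen for each state, which gives the kernel of the pair
    process.\<close>
  then have "\<exists>K. \<forall>s\<in>G. ?coupling s (K s)"
    by (intro bchoice) blast
  then obtain K where "\<forall>s\<in>G. ?coupling s (K s)"
    by (rule exE)
  then have K: "\<And>s x y. \<lbrakk>s \<in> G; (x, y) \<in> set_pmf (K s)\<rbrakk> \<Longrightarrow> x \<noteq> y \<and> {x, y} \<notin> E"
    and K_fst: "\<And>s. s \<in> G \<Longrightarrow> map_pmf fst (K s) = pmf_of_set (neighbours V E (fst s))"
    and K_snd: "\<And>s. s \<in> G \<Longrightarrow> map_pmf snd (K s) = pmf_of_set (neighbours V E (snd s))"
    by blast+
  \<comment> \<open>The support of a joint law projects onto the supports of its marginals.\<close>
  have K_nb: "x \<in> neighbours V E (fst s)" "y \<in> neighbours V E (snd s)"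
    if "s \<in> G" "(x, y) \<in> set_pmf (K s)" for s x y
  proof -
    have "fst s \<in> V" "snd s \<in> V"
      using that(1) by (auto simp: G_def)
    then have "fst ` set_pmf (K s) = neighbours V E (fst s)" "snd ` set_pmf (K s) = neighbours V E (snd s)"
      using K_fst[OF that(1)] K_snd[OF that(1)] nb by (metis set_map_pmf set_pmf_of_set)+
    with that(2) show "x \<in> neighbours V E (fst s)" "y \<in> neighbours V E (snd s)"
      by force+
  qed
  have closed: "set_pmf (K s) \<subseteq> G" if "s \<in> G" for s
    using K[OF that] K_nb[OF that] by (auto simp: G_def neighbours_def)
  obtain a0 b0 where "a0 \<in> V" "b0 \<in> V" "a0 \<noteq> b0" "{a0, b0} \<notin> E"
    by (rule nonadjacent_pair[OF assms(3,2) deg])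
  then have "(a0, b0) \<in> G"
    by (simp add: G_def)
  then obtain M where "finite_chain M G K"
    by (rule finite_chain_exists[OF \<open>finite G\<close> _ closed])
  then interpret finite_chain M G K .
  have "avoidance_coupling V E M (\<lambda>t \<omega>. fst (\<omega> t)) (\<lambda>t \<omega>. snd (\<omega> t))"
    unfolding avoidance_coupling_def
  proof (intro conjI allI)
    show "prob_space M"
      by (rule prob_space_axioms)
    have "(\<lambda>\<omega>. \<omega> t) \<in> measurable M (count_space (V \<times> V))" for t
      by (rule measurable_compose[OF state_measurable]) (auto simp: G_def)
    then show "(\<lambda>\<omega>. (fst (\<omega> t), snd (\<omega> t))) \<in> measurable M (count_space (V \<times> V))" for t
      by simp
    show "simple_random_walk V E M (\<lambda>t \<omega>. fst (\<omega> t))"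
      using K_fst nb(1) by (intro simple_random_walk_projection assms(2)) (auto simp: G_def)
    show "simple_random_walk V E M (\<lambda>t \<omega>. snd (\<omega> t))"
      using K_snd nb(1) by (intro simple_random_walk_projection assms(2)) (auto simp: G_def)
    show "AE \<omega> in M. \<forall>t. snd (\<omega> t) \<notin> {fst (\<omega> t), fst (\<omega> (Suc t))}"
      using steps_in_support
    proof (rule AE_mp, intro AE_I2 impI allI)
      fix \<omega> t assume \<omega>: "\<omega> \<in> space M" "\<forall>t. \<omega> (Suc t) \<in> set_pmf (K (\<omega> t))"
      \<comment> \<open>The first walker moves along an edge from its present vertex, and the second
        walker's vertex is not adjacent to that vertex.\<close>
      have "fst (\<omega> (Suc t)) \<in> neighbours V E (fst (\<omega> t))"
        using K_nb(1)[OF state_in[OF \<omega>(1)]] \<omega>(2) by (metis prod.collapse)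
      then have "{fst (\<omega> (Suc t)), fst (\<omega> t)} \<in> E"
        by (simp add: neighbours_def)
      moreover have "fst (\<omega> t) \<noteq> snd (\<omega> t)" "{fst (\<omega> t), snd (\<omega> t)} \<notin> E"
        using state_in[OF \<omega>(1), of t] by (auto simp: G_def)
      ultimately show "snd (\<omega> t) \<notin> {fst (\<omega> t), fst (\<omega> (Suc t))}"
        by (metis edge_commute insert_iff singletonD)
    qed
  qed
  then show ?thesis
    unfolding has_avoidance_coupling_def by blast
qed

end
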